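(* Suppose that $\mathbb{P}(\mathcal{B}(x))$ is a monotonically increasing function of $x\in\{0,1\}^n$. Let $\bar x\in\{0,1\}^n$ satisfy $\mathbb{P}(\mathcal{B}(\bar x))<1-\epsilon$, and let $J_0=\{i\in V_1:\bar x_i=0\}$ and $J_1=V_1\setminus J_0$. Let $\kappa(J_0)<|J_0|$ be a positive integer such that for every $\mathcal{K}\subseteq J_0$ with $|\mathcal{K}|=\kappa(J_0)-1$ we have $\mathbb{P}\big(\mathcal{B}(\bar x+\sum_{j\in\mathcal{K}}\mathbf{e}_j)\big)<1-\epsilon$. Then: (i) The inequality $$\sum_{j\in J_0}x_j\ge\kappa(J_0)\qquad(\ast)$$ is valid for the problem $\min\{b^\top x:\mathcal{A}(x)\ge 1-\epsilon,\ x\in\mathcal{X}\cap\{0,1\}^n\}$, i.e., it is satisfied by every feasible solution of this problem. (ii) Inequality $(\ast)$ is stronger than the no-good cut $$\sum_{i\in J_1}(1-x_i)+\sum_{j\in J_0}x_j\ge 1$$ for the same choice of $J_0$; that is, every $x\in[0,1]^n$ satisfying $(\ast)$ satisfies the no-good cut.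
   Context: $V_1=\{1,\dots,n\}$; $\mathbf{e}_j\in\{0,1\}^n$ is the $j$-th unit vector. For each $x\in\{0,1\}^n$, $\mathcal{B}(x)$ is a random event. $\epsilon\in[0,1]$ is a given risk level, $b\in\mathbb{R}^n$ a given cost vector, and $\mathcal{X}$ a set representing deterministic constraints on $x$. $\mathcal{A}(x)$ is an oracle returning exactly $\mathcal{A}(x)=\mathbb{P}(\mathcal{B}(x))$. "Monotonically increasing in $x$" means: $x\le x'$ componentwise implies $\mathbb{P}(\mathcal{B}(x))\le\mathbb{P}(\mathcal{B}(x'))$. *)

theory Defs
  imports "HOL-Probability.Probability"
begin

text \<open>
  Vectors are of type \<^typ>\<open>real ^ 'n\<close>, where the index type \<^typ>\<open>'n\<close> plays the role of the
  ground set $V_1$ of $n$ elements; its unit vectors are \<^term>\<open>axis j 1\<close>, and the library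
  order on \<^typ>\<open>real ^ 'n\<close> is the componentwise one.
\<close>

definition binary_vectors :: "(real ^ 'n) set" where
  "binary_vectors = {x. \<forall>i. x $ i = 0 \<or> x $ i = 1}"

definition unit_box :: "(real ^ 'n) set" where
  "unit_box = {x. \<forall>i. 0 \<le> x $ i \<and> x $ i \<le> 1}"

record 'a min_problem =
  objective :: "'a \<Rightarrow> real"
  feasible_set :: "'a set"

definition valid_for :: "('a \<Rightarrow> bool) \<Rightarrow> 'a min_problem \<Rightarrow> bool" where
  "valid_for ineq P \<longleftrightarrow> (\<forall>x \<in> feasible_set P. ineq x)"

definition chance_constrained_problem ::
  "real ^ 'n \<Rightarrow> (real ^ 'n \<Rightarrow> real) \<Rightarrow> real \<Rightarrow> (real ^ 'n) set \<Rightarrow> (real ^ 'n) min_problem" where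
  "chance_constrained_problem b \<A> \<epsilon> X =
     \<lparr> objective = (\<lambda>x. b \<bullet> x),
       feasible_set = {x \<in> X \<inter> binary_vectors. \<A> x \<ge> 1 - \<epsilon>} \<rparr>"

end

theory Submission
  imports Defs
begin

text \<open>
  Suppose a feasible binary point \<open>x\<close> switched on fewer than \<open>\<kappa>\<close> of the coordinates that vanish
  in \<open>xbar\<close>. Those coordinates fit into a set \<open>K\<close> of exactly \<open>\<kappa> - 1\<close> elements of \<open>J0\<close>, and then
  \<open>x\<close> lies below \<open>xbar\<close> with the coordinates in \<open>K\<close> raised to 1: on \<open>J1\<close> because \<open>xbar\<close> already
  has the largest value there, on \<open>J0\<close> by the choice of \<open>K\<close>. Monotonicity bounds the probability
  at \<open>x\<close> by the probability at the raised point, which is below \<open>1 - \<epsilon>\<close>, so \<open>x\<close> was not feasible.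
  The domination is \<open>binary_le_raised\<close>; the other lemmas describe the raised point and count.

  The no-good cut is weaker because its right-hand side 1 is at most \<open>\<kappa>\<close> and its extra terms
  \<open>1 - x\<^sub>i\<close> are nonnegative on the unit box.
\<close>

lemma raised_nth:
  fixes y :: "real ^ 'n"
  shows "(y + (\<Sum>j\<in>K. axis j 1)) $ i = y $ i + (if i \<in> K then 1 else 0)"
  by (simp add: axis_def)

lemma raised_binary:
  fixes y :: "real ^ 'n"
  assumes "y \<in> binary_vectors" and "K \<subseteq> {i. y $ i = 0}"
  shows "y + (\<Sum>j\<in>K. axis j 1) \<in> binary_vectors"
  using assms unfolding binary_vectors_def by (auto simp del: vector_add_component simp: raised_nth)

text \<open>
  Where \<open>y\<close> is 1 it already dominates every binary vector, so only the coordinates where \<open>y\<close> is 0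
  and \<open>x\<close> is 1 have to be raised. Raising further ones keeps the bound, which leaves room to pad
  \<open>K\<close> to a prescribed size.
\<close>

lemma binary_le_raised:
  fixes x y :: "real ^ 'n"
  assumes x: "x \<in> binary_vectors" and y: "y \<in> binary_vectors"
    and K: "{i. y $ i = 0 \<and> x $ i = 1} \<subseteq> K"
  shows "x \<le> y + (\<Sum>j\<in>K. axis j 1)"
  unfolding less_eq_vec_def raised_nth
proof
  fix i
  have "x $ i = 0 \<or> x $ i = 1" "y $ i = 0 \<or> y $ i = 1"
    using x y by (simp_all add: binary_vectors_def)
  then show "x $ i \<le> y $ i + (if i \<in> K then 1 else 0)"
    using K by auto
qed

lemma sum_binary_eq_card:
  fixes x :: "real ^ 'n"
  assumes "x \<in> binary_vectors"
  shows "(\<Sum>j\<in>J. x $ j) = real (card {j \<in> J. x $ j = 1})"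
proof -
  have "(\<Sum>j\<in>J. x $ j) = (\<Sum>j\<in>J. if x $ j = 1 then 1 else 0)"
    using assms by (intro sum.cong) (auto simp: binary_vectors_def)
  also have "\<dots> = (\<Sum>j\<in>{j \<in> J. x $ j = 1}. 1)"
    by (rule sum.inter_filter[symmetric]) simp
  finally show ?thesis by simp
qed

theorem proposition2p1:
  fixes M :: "'w measure"
    and B :: "real ^ 'n \<Rightarrow> 'w set"
    and \<A> :: "real ^ 'n \<Rightarrow> real"
    and \<epsilon> :: real
    and b :: "real ^ 'n"
    and X :: "(real ^ 'n) set"
    and xbar :: "real ^ 'n"
    and J0 J1 :: "'n set"
    and \<kappa> :: nat
  assumes "prob_space M"
    and "\<And>x. x \<in> binary_vectors \<Longrightarrow> B x \<in> sets M"
    and "\<And>x. x \<in> binary_vectors \<Longrightarrow> \<A> x = measure M (B x)"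
    and "0 \<le> \<epsilon>" and "\<epsilon> \<le> 1"
    and "mono_on binary_vectors (\<lambda>x. measure M (B x))"
    and "xbar \<in> binary_vectors"
    and "measure M (B xbar) < 1 - \<epsilon>"
    and "J0 = {i. xbar $ i = 0}"
    and "J1 = UNIV - J0"
    and "0 < \<kappa>" and "\<kappa> < card J0"
    and "\<And>K. K \<subseteq> J0 \<Longrightarrow> card K = \<kappa> - 1 \<Longrightarrow>
           measure M (B (xbar + (\<Sum>j\<in>K. axis j 1))) < 1 - \<epsilon>"
  shows "valid_for (\<lambda>x. (\<Sum>j\<in>J0. x $ j) \<ge> real \<kappa>) (chance_constrained_problem b \<A> \<epsilon> X)
    \<and> (\<forall>x \<in> unit_box. (\<Sum>j\<in>J0. x $ j) \<ge> real \<kappa> \<longrightarrow>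
          (\<Sum>i\<in>J1. 1 - x $ i) + (\<Sum>j\<in>J0. x $ j) \<ge> 1)"
proof (intro conjI ballI impI)
  show "valid_for (\<lambda>x. (\<Sum>j\<in>J0. x $ j) \<ge> real \<kappa>) (chance_constrained_problem b \<A> \<epsilon> X)"
    unfolding valid_for_def
  proof (rule ballI, rule ccontr)
    fix x
    assume feasible: "x \<in> feasible_set (chance_constrained_problem b \<A> \<epsilon> X)"
      and violated: "\<not> (\<Sum>j\<in>J0. x $ j) \<ge> real \<kappa>"
    have x: "x \<in> binary_vectors" and reliable: "\<A> x \<ge> 1 - \<epsilon>"
      using feasible by (auto simp: chance_constrained_problem_def)
    let ?S = "{j \<in> J0. x $ j = 1}"
    have "card ?S \<le> \<kappa> - 1"
      using violated sum_binary_eq_card[OF x, of J0] by simp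
    \<comment> \<open>The assumption on the raised points speaks only of sets of size exactly \<open>\<kappa> - 1\<close>, so the
      possibly smaller set of switched-on coordinates is padded within \<open>J0\<close>.\<close>
    moreover have "\<kappa> - 1 \<le> card J0"
      using assms(12) by simp
    ultimately obtain K where K: "?S \<subseteq> K" "K \<subseteq> J0" "card K = \<kappa> - 1"
      using exists_subset_between[of ?S "\<kappa> - 1" J0] by auto
    let ?z = "xbar + (\<Sum>j\<in>K. axis j 1)"
    have "?z \<in> binary_vectors"
      using raised_binary[OF assms(7)] K(2) assms(9) by simp
    moreover have "x \<le> ?z"
      using binary_le_raised[OF x assms(7)] K(1) assms(9) by simp
    ultimately have "measure M (B x) \<le> measure M (B ?z)"
      using mono_onD[OF assms(6) x] by simp
    also have "\<dots> < 1 - \<epsilon>"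
      using assms(13) K by simp
    finally show False
      using reliable assms(3)[OF x] by simp
  qed
next
  fix x :: "real ^ 'n"
  assume box: "x \<in> unit_box" and cut: "(\<Sum>j\<in>J0. x $ j) \<ge> real \<kappa>"
  have "(\<Sum>i\<in>J1. 1 - x $ i) \<ge> 0"
    using box by (intro sum_nonneg) (simp add: unit_box_def)
  moreover have "real \<kappa> \<ge> 1"
    using assms(11) by simp
  ultimately show "(\<Sum>i\<in>J1. 1 - x $ i) + (\<Sum>j\<in>J0. x $ j) \<ge> 1"
    using cut by linarith
qed

end
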